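(* Suppose the charging station knows the realized utilities $(u_{k,l,t})_{l,t}$ of user $k$. Let $(l^{*},t^{*})\in\operatorname{argmax}_{l,t}\{u_{k,l,t}-v_{l,t}\}$ and set $$p_{k,l,t}=v_{l,t}-v_{-k}+(u_{k,l^{*},t^{*}}-v_{l^{*},t^{*}}+v_{-k})^{+}\qquad (l\in\{1,\dots,L\},\ t\in\{t_k+1,\dots,T\}),$$ where $x^+=\max\{x,0\}$. Then this pricing strategy maximizes, over all price menus $\mathbf p_k=(p_{k,l,t})_{l,t}$ with $p_{k,l,t}\ge0$, the profit of the charging station $$\sum_{l=1}^{L}\sum_{t=t_k+1}^{T}(p_{k,l,t}-v_{l,t}+v_{-k})A_{k,l,t}(\mathbf p_k),$$ as well as the social welfare $$\sum_{l=1}^{L}\sum_{t=t_k+1}^{T}(u_{k,l,t}-v_{l,t}+v_{-k})A_{k,l,t}(\mathbf p_k).$$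
   Context: Contracts and user. User $k$ arrives at a charging station at time $t_k<T$ (discrete time, horizon $T$). A contract is a pair $(l,t)$ with energy level $l\in\{1,\dots,L\}$ and deadline $t\in\{t_k+1,\dots,T\}$. The station posts a price $p_{k,l,t}\ge 0$ for every contract; $\mathbf p_k=(p_{k,l,t})_{l,t}$ (the value $+\infty$ is allowed; a contract with infinite price is never accepted, and its terms in all sums are read as $0$). User $k$ has realized real utility $u_{k,l,t}$ for contract $(l,t)$, and utility $0$ if it rejects all contracts. Given $\mathbf p_k$ the user is a price taker and chooses $A_{k,l,t}(\mathbf p_k)\in[0,1]$ to maximize $\sum_{l,t}A_{k,l,t}(u_{k,l,t}-p_{k,l,t})$ subject to $\sum_{l,t}A_{k,l,t}\le 1$: it chooses a contract (or any convex combination of contracts) attaining the maximal payoff $\max_{i,j}(u_{k,i,j}-p_{k,i,j})$ if this maximum is $\ge 0$ (ties between charging and not charging are resolved in favour of charging, so then $\sum_{l,t} A_{k,l,t}=1$), and all $A_{k,l,t}=0$ if the maximum is negative. Costs. $\mathcal K_0$ is the set of users already present at time $t_k$; user $i\in\mathcal K_0$ has deadline $w_i$ and remaining demand $N_i$. Known data: conventional energy prices $c_t\ge0$, harvested energies $\bar E^t\ge 0$, maximal charging rate $R_{max}$, battery capacity $B_{max}$, initial battery level $B_0\in[0,B_{max}]$. For a contract $(l,d)$, $v_{l,d}$ is the optimal value of the linear program: minimize $\sum_{t=t_k}^{T-1}c_tq_t$ over nonnegative variables $r_{k,t},q_{k,t},r_{i,t},q_{i,t}\ (i\in\mathcal K_0),\,q_t,r_t,D_t$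 (for $t_k\le t\le T-1$) and battery levels $B^t$, subject to (a) $\sum_{t=t_k}^{d-1}(r_{k,t}+q_{k,t})\ge l$; (b) $\sum_{t=t_k}^{w_i-1}(r_{i,t}+q_{i,t})\ge N_i$ for all $i\in\mathcal K_0$; (c) $r_{k,t}+q_{k,t}\le R_{max}$ and $r_{i,t}+q_{i,t}\le R_{max}$ for all $i\in\mathcal K_0$ and all $t$; (d) $r_{k,t}+\sum_{i\in\mathcal K_0}r_{i,t}=r_t$ and $q_{k,t}+\sum_{i\in\mathcal K_0}q_{i,t}\le q_t$ for all $t$; (e) $B^{t+1}=B^t+\bar E^t-r_t+q_t-q_{k,t}-\sum_{i\in\mathcal K_0}q_{i,t}-D_t$, $0\le B^{t+1}\le B_{max}$, $B^{t_k}=B_0$, $B^T=B_0$. If the program is infeasible, $v_{l,d}=\infty$. $v_{-k}$ is the optimal value of the same program with $r_{k,t}=q_{k,t}=0$ for all $t$ and constraint (a) dropped (the cost of serving only the existing users), assumed finite. These costs do not depend on the prices, and $v_{l,t}-v_{-k}\ge 0$. *)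

theory Defs
  imports Complex_Main "HOL-Library.Extended_Real"
begin

text \<open>
  The data known to the station when the new user \<open>k\<close> arrives. The existing users are indexed by a
  set of type \<open>'i set\<close>; the new user is not a member of it and has variables of its own below.
\<close>

record 'i station =
  arrival :: nat                     \<comment> \<open>\<open>t\<^sub>k\<close>\<close>
  horizon :: nat                     \<comment> \<open>\<open>T\<close>\<close>
  levels :: nat                      \<comment> \<open>\<open>L\<close>\<close>
  users :: "'i set"                  \<comment> \<open>\<open>K\<^sub>0\<close>\<close>
  deadline :: "'i \<Rightarrow> nat"            \<comment> \<open>\<open>w\<^sub>i\<close>\<close>
  demand :: "'i \<Rightarrow> real"             \<comment> \<open>\<open>N\<^sub>i\<close>\<close>
  energy_price :: "nat \<Rightarrow> real"      \<comment> \<open>\<open>c\<^sub>t\<close>\<close>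
  harvest :: "nat \<Rightarrow> real"           \<comment> \<open>\<open>E\<^sup>t\<close>\<close>
  rate_max :: real                   \<comment> \<open>\<open>R\<^sub>m\<^sub>a\<^sub>x\<close>\<close>
  battery_max :: real                \<comment> \<open>\<open>B\<^sub>m\<^sub>a\<^sub>x\<close>\<close>
  battery_init :: real               \<comment> \<open>\<open>B\<^sub>0\<close>\<close>

record 'i schedule =
  rnew :: "nat \<Rightarrow> real"              \<comment> \<open>\<open>r\<^sub>k\<^sub>,\<^sub>t\<close>\<close>
  qnew :: "nat \<Rightarrow> real"              \<comment> \<open>\<open>q\<^sub>k\<^sub>,\<^sub>t\<close>\<close>
  rold :: "'i \<Rightarrow> nat \<Rightarrow> real"        \<comment> \<open>\<open>r\<^sub>i\<^sub>,\<^sub>t\<close>\<close>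
  qold :: "'i \<Rightarrow> nat \<Rightarrow> real"        \<comment> \<open>\<open>q\<^sub>i\<^sub>,\<^sub>t\<close>\<close>
  qtot :: "nat \<Rightarrow> real"              \<comment> \<open>\<open>q\<^sub>t\<close>\<close>
  rtot :: "nat \<Rightarrow> real"              \<comment> \<open>\<open>r\<^sub>t\<close>\<close>
  discard :: "nat \<Rightarrow> real"           \<comment> \<open>\<open>D\<^sub>t\<close>\<close>
  battery :: "nat \<Rightarrow> real"           \<comment> \<open>\<open>B\<^sup>t\<close>\<close>

definition slots :: "'i station \<Rightarrow> nat set" where
  "slots S = {arrival S..<horizon S}"

definition contracts :: "'i station \<Rightarrow> (nat \<times> nat) set" where
  "contracts S = {1..levels S} \<times> {arrival S + 1..horizon S}"

text \<open>All constraints of the linear program except the demand constraint of the new user.\<close>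

definition feasible :: "'i station \<Rightarrow> 'i schedule \<Rightarrow> bool" where
  "feasible S x \<longleftrightarrow>
     (\<forall>t\<in>slots S. 0 \<le> rnew x t \<and> 0 \<le> qnew x t \<and> 0 \<le> qtot x t \<and> 0 \<le> rtot x t \<and> 0 \<le> discard x t \<and>
        (\<forall>i\<in>users S. 0 \<le> rold x i t \<and> 0 \<le> qold x i t)) \<and>
     (\<forall>i\<in>users S. (\<Sum>t\<in>{arrival S..<deadline S i}. rold x i t + qold x i t) \<ge> demand S i) \<and>
     (\<forall>t\<in>slots S. rnew x t + qnew x t \<le> rate_max S \<and>
        (\<forall>i\<in>users S. rold x i t + qold x i t \<le> rate_max S)) \<and>
     (\<forall>t\<in>slots S. rnew x t + (\<Sum>i\<in>users S. rold x i t) = rtot x t \<and>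
        qnew x t + (\<Sum>i\<in>users S. qold x i t) \<le> qtot x t) \<and>
     (\<forall>t\<in>slots S.
        battery x (t + 1) = battery x t + harvest S t - rtot x t + qtot x t - qnew x t
          - (\<Sum>i\<in>users S. qold x i t) - discard x t \<and>
        0 \<le> battery x (t + 1) \<and> battery x (t + 1) \<le> battery_max S) \<and>
     battery x (arrival S) = battery_init S \<and> battery x (horizon S) = battery_init S"

definition serves :: "'i station \<Rightarrow> nat \<Rightarrow> nat \<Rightarrow> 'i schedule \<Rightarrow> bool" where
  "serves S l d x \<longleftrightarrow> (\<Sum>t\<in>{arrival S..<d}. rnew x t + qnew x t) \<ge> real l"

definition energy_cost :: "'i station \<Rightarrow> 'i schedule \<Rightarrow> real" where
  "energy_cost S x = (\<Sum>t\<in>slots S. energy_price S t * qtot x t)"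

text \<open>
  Optimal values are infima in the extended reals, so that an infeasible program has value
  \<open>Inf {} = \<infinity>\<close>. \<open>serving_cost\<close> is \<open>v\<^sub>l\<^sub>,\<^sub>d\<close> and \<open>base_cost\<close> is \<open>v\<^sub>-\<^sub>k\<close>.
\<close>

definition serving_cost :: "'i station \<Rightarrow> nat \<Rightarrow> nat \<Rightarrow> ereal" where
  "serving_cost S l d = (INF x\<in>{x. feasible S x \<and> serves S l d x}. ereal (energy_cost S x))"

definition base_cost :: "'i station \<Rightarrow> ereal" where
  "base_cost S =
     (INF x\<in>{x. feasible S x \<and> (\<forall>t\<in>slots S. rnew x t = 0 \<and> qnew x t = 0)}.
        ereal (energy_cost S x))"

type_synonym menu = "nat \<Rightarrow> nat \<Rightarrow> ereal"

definition price_menu :: "'i station \<Rightarrow> menu \<Rightarrow> bool" where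
  "price_menu S p \<longleftrightarrow> (\<forall>(l,t)\<in>contracts S. 0 \<le> p l t)"

text \<open>
  The sum of \<open>g l t * a l t\<close> over all contracts, where the terms of contracts with infinite price
  are read as 0.
\<close>

definition menu_sum ::
    "'i station \<Rightarrow> menu \<Rightarrow> (nat \<Rightarrow> nat \<Rightarrow> ereal) \<Rightarrow> (nat \<Rightarrow> nat \<Rightarrow> real) \<Rightarrow> ereal" where
  "menu_sum S p g a =
     (\<Sum>(l,t)\<in>contracts S. if p l t = \<infinity> then 0 else g l t * ereal (a l t))"

definition user_choices :: "'i station \<Rightarrow> menu \<Rightarrow> (nat \<Rightarrow> nat \<Rightarrow> real) set" where
  "user_choices S p =
     {a. (\<forall>(l,t)\<in>contracts S. 0 \<le> a l t \<and> a l t \<le> 1 \<and> (p l t = \<infinity> \<longrightarrow> a l t = 0)) \<and>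
         (\<Sum>(l,t)\<in>contracts S. a l t) \<le> 1}"

definition user_payoff ::
    "'i station \<Rightarrow> (nat \<Rightarrow> nat \<Rightarrow> real) \<Rightarrow> menu \<Rightarrow> (nat \<Rightarrow> nat \<Rightarrow> real) \<Rightarrow> ereal" where
  "user_payoff S u p a = menu_sum S p (\<lambda>l t. ereal (u l t) - p l t) a"

definition best_payoff :: "'i station \<Rightarrow> (nat \<Rightarrow> nat \<Rightarrow> real) \<Rightarrow> menu \<Rightarrow> ereal" where
  "best_payoff S u p = Max ((\<lambda>(l,t). ereal (u l t) - p l t) ` contracts S)"

text \<open>
  The optimal choices of a price-taking user, with ties between charging and not charging resolved
  in favour of charging. There may be several: any convex combination of the contracts attaining the
  best payoff is allowed.
\<close>

definition user_response ::
    "'i station \<Rightarrow> (nat \<Rightarrow> nat \<Rightarrow> real) \<Rightarrow> menu \<Rightarrow> (nat \<Rightarrow> nat \<Rightarrow> real) \<Rightarrow> bool" where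
  "user_response S u p a \<longleftrightarrow>
     is_arg_max (user_payoff S u p) (\<lambda>b. b \<in> user_choices S p) a \<and>
     (best_payoff S u p \<ge> 0 \<longrightarrow> (\<Sum>(l,t)\<in>contracts S. a l t) = 1) \<and>
     (best_payoff S u p < 0 \<longrightarrow> (\<forall>(l,t)\<in>contracts S. a l t = 0))"

definition profit :: "'i station \<Rightarrow> menu \<Rightarrow> (nat \<Rightarrow> nat \<Rightarrow> real) \<Rightarrow> ereal" where
  "profit S p a = menu_sum S p (\<lambda>l t. p l t - serving_cost S l t + base_cost S) a"

definition social_welfare ::
    "'i station \<Rightarrow> (nat \<Rightarrow> nat \<Rightarrow> real) \<Rightarrow> menu \<Rightarrow> (nat \<Rightarrow> nat \<Rightarrow> real) \<Rightarrow> ereal" where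
  "social_welfare S u p a =
     menu_sum S p (\<lambda>l t. ereal (u l t) - serving_cost S l t + base_cost S) a"

end

theory Submission
  imports Defs
begin

text \<open>
  Let \<open>W\<close> be the largest value of \<open>u\<^sub>l\<^sub>,\<^sub>t - v\<^sub>l\<^sub>,\<^sub>t + v\<^sub>-\<^sub>k\<close> over all contracts. Whatever the prices, the
  user spreads a total weight of at most one over the contracts, so the welfare is at most
  \<open>W\<^sup>+\<close> (\<open>welfare_bound\<close>). The welfare is the profit plus the payoff of the user
  (\<open>welfare_eq_profit_plus_payoff\<close>), and the user never accepts a negative payoff because it may
  reject everything (\<open>user_payoff_nonneg\<close>). Hence the profit is bounded by the welfare and so by
  \<open>W\<^sup>+\<close> as well.

  The proposed menu reaches both bounds. It adds the constant margin \<open>W\<^sup>+\<close> to the marginal cost, so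
  the station earns \<open>W\<^sup>+\<close> times the total weight. If \<open>W > 0\<close>, the contract attaining
  \<open>W\<close> is priced exactly at its utility, and the tie rule forces total
  weight one. If \<open>W \<le> 0\<close>, the margin is zero and so is the profit. In both cases the profit is \<open>W\<^sup>+\<close>,
  and the welfare lies between the profit and \<open>W\<^sup>+\<close>.

  That the menu has nonnegative prices amounts to \<open>v\<^sub>-\<^sub>k \<le> v\<^sub>l\<^sub>,\<^sub>t\<close> (\<open>base_cost_le_serving_cost\<close>). This
  inequality also rules out \<open>v\<^sub>l\<^sub>,\<^sub>t = -\<infinity>\<close>, so that \<open>W < \<infinity>\<close>. A contract that cannot be served costs
  \<open>\<infinity>\<close>. The proposed menu prices it at \<open>\<infinity>\<close>, and under any menu that prices it lower, giving it
  positive weight makes profit and welfare \<open>-\<infinity>\<close>.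
\<close>

lemma finite_contracts: "finite (contracts S)"
  by (simp add: contracts_def)

text \<open>
  Any schedule becomes a schedule for the existing users alone, with the same battery levels:
  energy drawn from the battery for the new user is discarded, and conventional energy meant for it
  is not bought, which cannot raise the cost.
\<close>

lemma base_cost_le_serving_cost:
  assumes "\<And>t. t \<in> slots S \<Longrightarrow> 0 \<le> energy_price S t"
  shows "base_cost S \<le> serving_cost S l d"
  unfolding serving_cost_def
proof (rule INF_greatest)
  fix x assume "x \<in> {x. feasible S x \<and> serves S l d x}"
  then have x: "feasible S x" by simp
  define y where "y = x\<lparr>rnew := \<lambda>_. 0, qnew := \<lambda>_. 0, rtot := \<lambda>t. rtot x t - rnew x t,
     qtot := \<lambda>t. qtot x t - qnew x t, discard := \<lambda>t. discard x t + rnew x t\<rparr>"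
  have nonneg: "0 \<le> rnew x t" "0 \<le> qnew x t" "0 \<le> discard x t"
      "\<And>i. i \<in> users S \<Longrightarrow> 0 \<le> rold x i t \<and> 0 \<le> qold x i t"
    and balance: "rnew x t + (\<Sum>i\<in>users S. rold x i t) = rtot x t"
      "qnew x t + (\<Sum>i\<in>users S. qold x i t) \<le> qtot x t"
    if "t \<in> slots S" for t
    using x that unfolding feasible_def by blast+
  have old: "0 \<le> (\<Sum>i\<in>users S. rold x i t)" "0 \<le> (\<Sum>i\<in>users S. qold x i t)"
    if "t \<in> slots S" for t
    using nonneg(4)[OF that] by (simp_all add: sum_nonneg)
  have rate: "\<forall>t\<in>slots S. 0 \<le> rate_max S"
    using x nonneg unfolding feasible_def by (meson add_nonneg_nonneg order_trans)
  have "\<forall>t\<in>slots S. 0 \<le> rtot x t - rnew x t \<and> 0 \<le> qtot x t - qnew x t \<and>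
      0 \<le> discard x t + rnew x t \<and> (\<Sum>i\<in>users S. rold x i t) = rtot x t - rnew x t \<and>
      (\<Sum>i\<in>users S. qold x i t) \<le> qtot x t - qnew x t"
  proof
    fix t assume t: "t \<in> slots S"
    show "0 \<le> rtot x t - rnew x t \<and> 0 \<le> qtot x t - qnew x t \<and>
      0 \<le> discard x t + rnew x t \<and> (\<Sum>i\<in>users S. rold x i t) = rtot x t - rnew x t \<and>
      (\<Sum>i\<in>users S. qold x i t) \<le> qtot x t - qnew x t"
      using nonneg[OF t] balance[OF t] old[OF t] by linarith
  qed
  with x rate have "feasible S y"
    unfolding feasible_def y_def by auto
  moreover have "energy_cost S y \<le> energy_cost S x"
    unfolding energy_cost_def y_def
    using assms nonneg(2) by (auto intro!: sum_mono mult_left_mono)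
  ultimately show "base_cost S \<le> ereal (energy_cost S x)"
    unfolding base_cost_def by (intro INF_lower2[of y]) (auto simp: y_def)
qed

text \<open>Rejecting every contract is one of the choices of the user.\<close>

lemma user_payoff_nonneg:
  assumes "user_response S u p a"
  shows "0 \<le> user_payoff S u p a"
proof -
  have "(\<lambda>_ _. 0) \<in> user_choices S p"
    by (auto simp: user_choices_def)
  then have "user_payoff S u p (\<lambda>_ _. 0) \<le> user_payoff S u p a"
    using assms unfolding user_response_def is_arg_max_def by (meson not_less)
  moreover have "user_payoff S u p (\<lambda>_ _. 0) = 0"
    unfolding user_payoff_def menu_sum_def zero_ereal_def[symmetric]
    by (intro sum.neutral) auto
  ultimately show ?thesis by simp
qed

lemma user_response_choice:
  assumes "user_response S u p a" "(l, t) \<in> contracts S"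
  shows "0 \<le> a l t" "p l t = \<infinity> \<Longrightarrow> a l t = 0"
  using assms unfolding user_response_def is_arg_max_def user_choices_def by auto

text \<open>
  Payments cancel between the user and the station. The equation survives \<open>v\<^sub>l\<^sub>,\<^sub>t = \<infinity>\<close>, since both
  sides of a term are then \<open>-\<infinity>\<close>, or both are zero if the contract is not chosen.
\<close>

lemma welfare_eq_profit_plus_payoff:
  assumes "price_menu S p" "user_response S u p a" "\<bar>base_cost S\<bar> \<noteq> \<infinity>"
    and "\<And>l t. base_cost S \<le> serving_cost S l t"
  shows "social_welfare S u p a = profit S p a + user_payoff S u p a"
proof -
  obtain b where b: "base_cost S = ereal b" using assms(3) by auto
  have "(ereal (u l t) - serving_cost S l t + base_cost S) * ereal (a l t)
      = (p l t - serving_cost S l t + base_cost S) * ereal (a l t)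
        + (ereal (u l t) - p l t) * ereal (a l t)"
    if lt: "(l, t) \<in> contracts S" and "p l t \<noteq> \<infinity>" for l t
  proof -
    have "0 \<le> p l t" using assms(1) lt by (auto simp: price_menu_def)
    then obtain q where q: "p l t = ereal q" using \<open>p l t \<noteq> \<infinity>\<close> by (cases "p l t") auto
    have a: "0 \<le> a l t" using user_response_choice(1)[OF assms(2) lt] .
    show ?thesis
    proof (cases "serving_cost S l t")
      case (real c)
      then show ?thesis by (simp add: b q algebra_simps)
    next
      case PInf
      then show ?thesis using a by (cases "a l t = 0") (auto simp: b q zero_ereal_def[symmetric])
    next
      case MInf
      then show ?thesis using assms(4)[of l t] by (simp add: b)
    qed
  qed
  then show ?thesis
    unfolding social_welfare_def profit_def user_payoff_def menu_sum_def sum.distrib[symmetric]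
    by (intro sum.cong) auto
qed

lemma welfare_bound:
  assumes "user_response S u p a" "0 \<le> m"
    and bound: "\<And>l t. (l, t) \<in> contracts S \<Longrightarrow>
      ereal (u l t) - serving_cost S l t + base_cost S \<le> ereal m"
  shows "social_welfare S u p a \<le> ereal m"
proof -
  have "social_welfare S u p a \<le> (\<Sum>(l,t)\<in>contracts S. ereal (m * a l t))"
    unfolding social_welfare_def menu_sum_def
  proof (intro sum_mono, clarify)
    fix l t assume lt: "(l, t) \<in> contracts S"
    have "0 \<le> a l t" using user_response_choice(1)[OF assms(1) lt] .
    then have "(ereal (u l t) - serving_cost S l t + base_cost S) * ereal (a l t)
        \<le> ereal m * ereal (a l t)"
      by (intro ereal_mult_right_mono bound lt) auto
    with \<open>0 \<le> a l t\<close> assms(2)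
    show "(if p l t = \<infinity> then 0
        else (ereal (u l t) - serving_cost S l t + base_cost S) * ereal (a l t))
      \<le> ereal (m * a l t)" by simp
  qed
  also have "\<dots> = ereal (m * (\<Sum>(l,t)\<in>contracts S. a l t))"
    by (simp add: sum_distrib_left case_prod_unfold)
  also have "m * (\<Sum>(l,t)\<in>contracts S. a l t) \<le> m * 1"
    using assms(1)
    by (intro mult_left_mono assms(2)) (simp add: user_response_def is_arg_max_def user_choices_def)
  finally show ?thesis by simp
qed

text \<open>
  When every price that can be accepted exceeds the marginal cost by the same \<open>m\<close>, only the total
  weight matters for the profit, not its distribution over the contracts.
\<close>

lemma profit_constant_margin:
  assumes "user_response S u p a"
    and margin: "\<And>l t. (l, t) \<in> contracts S \<Longrightarrow> p l t \<noteq> \<infinity> \<Longrightarrow>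
      p l t - serving_cost S l t + base_cost S = ereal m"
  shows "profit S p a = ereal (m * (\<Sum>(l,t)\<in>contracts S. a l t))"
proof -
  have "profit S p a = (\<Sum>(l,t)\<in>contracts S. ereal (m * a l t))"
    unfolding profit_def menu_sum_def
    using user_response_choice(2)[OF assms(1)] margin
    by (intro sum.cong) (auto simp: zero_ereal_def)
  then show ?thesis
    by (simp add: sum_distrib_left case_prod_unfold)
qed

theorem theorem3:
  fixes S :: "'i station"
    and u :: "nat \<Rightarrow> nat \<Rightarrow> real"
    and A :: "menu \<Rightarrow> nat \<Rightarrow> nat \<Rightarrow> real"
    and ls ts :: nat
    and pstar :: menu
  assumes "arrival S < horizon S"
    and "finite (users S)"
    and "\<And>t. t \<in> slots S \<Longrightarrow> 0 \<le> energy_price S t"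
    and "\<And>t. t \<in> slots S \<Longrightarrow> 0 \<le> harvest S t"
    and "0 \<le> battery_init S" and "battery_init S \<le> battery_max S"
    and "\<bar>base_cost S\<bar> \<noteq> \<infinity>"
    and response: "\<And>p. price_menu S p \<Longrightarrow> user_response S u p (A p)"
    and argmax: "is_arg_max (\<lambda>(l,t). ereal (u l t) - serving_cost S l t)
                   (\<lambda>x. x \<in> contracts S) (ls, ts)"
    and pstar: "\<And>l t. (l, t) \<in> contracts S \<Longrightarrow>
                  pstar l t = serving_cost S l t - base_cost S
                    + max (ereal (u ls ts) - serving_cost S ls ts + base_cost S) 0"
  shows "is_arg_max (\<lambda>p. profit S p (A p)) (price_menu S) pstar \<and>
         is_arg_max (\<lambda>p. social_welfare S u p (A p)) (price_menu S) pstar"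
proof -
  have cost: "base_cost S \<le> serving_cost S l t" for l t
    using base_cost_le_serving_cost assms(3) .
  obtain b where b: "base_cost S = ereal b" using assms(7) by auto
  define W where "W = ereal (u ls ts) - serving_cost S ls ts + base_cost S"
  have best: "(ls, ts) \<in> contracts S"
    using argmax by (simp add: is_arg_max_def)
  have W_max: "ereal (u l t) - serving_cost S l t + base_cost S \<le> W"
    if "(l, t) \<in> contracts S" for l t
    using argmax that unfolding W_def is_arg_max_def
    by (intro add_right_mono) (auto simp: not_less)
  have "W \<noteq> \<infinity>"
    using cost[of ls ts] unfolding W_def b by (cases "serving_cost S ls ts") auto
  then have "\<bar>max W 0\<bar> \<noteq> \<infinity>"
    by (cases W) (auto simp: max_def)
  then obtain m where m: "max W 0 = ereal m"
    by (cases "max W 0") auto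
  then have m0: "0 \<le> m" by (metis ereal_less_eq(5) max.cobounded2)
  have price: "pstar l t = serving_cost S l t - ereal b + ereal m"
    if "(l, t) \<in> contracts S" for l t
    using pstar[OF that] m unfolding W_def b by simp
  have menu: "price_menu S pstar"
    unfolding price_menu_def
  proof clarify
    fix l t assume lt: "(l, t) \<in> contracts S"
    show "0 \<le> pstar l t"
      using cost[of l t] m0 unfolding price[OF lt] b by (cases "serving_cost S l t") auto
  qed
  have upper_welfare: "social_welfare S u p (A p) \<le> ereal m" if "price_menu S p" for p
    using welfare_bound[OF response[OF that] m0] W_max m
    by (metis max.cobounded1 order_trans)
  have profit_le_welfare: "profit S p (A p) \<le> social_welfare S u p (A p)"
    if "price_menu S p" for p
    unfolding welfare_eq_profit_plus_payoff[OF that response[OF that] assms(7) cost]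
    using user_payoff_nonneg[OF response[OF that]] by (simp add: ereal_le_add_self)
  have "profit S pstar (A pstar) = ereal (m * (\<Sum>(l,t)\<in>contracts S. A pstar l t))"
  proof (rule profit_constant_margin[OF response[OF menu]])
    fix l t assume lt: "(l, t) \<in> contracts S" and "pstar l t \<noteq> \<infinity>"
    then show "pstar l t - serving_cost S l t + base_cost S = ereal m"
      using cost[of l t] unfolding price[OF lt] b by (cases "serving_cost S l t") auto
  qed
  also have "\<dots> = ereal m"
  proof (cases "m = 0")
    case False
    then have W: "W = ereal m" using m by (auto simp: max_def zero_ereal_def split: if_splits)
    \<comment> \<open>A positive margin leaves the user exactly indifferent at the best contract.\<close>
    then have "ereal (u ls ts) - pstar ls ts = 0"
      using cost[of ls ts] unfolding price[OF best] W_def b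
      by (cases "serving_cost S ls ts") auto
    moreover have "ereal (u ls ts) - pstar ls ts \<le> best_payoff S u pstar"
      unfolding best_payoff_def using best finite_contracts by (intro Max_ge) force+
    ultimately have "(\<Sum>(l,t)\<in>contracts S. A pstar l t) = 1"
      using response[OF menu] unfolding user_response_def by simp
    then show ?thesis by simp
  qed simp
  finally have attained: "profit S pstar (A pstar) = ereal m" .
  show ?thesis
    unfolding is_arg_max_def not_ex
    using menu attained upper_welfare profit_le_welfare by (metis leD order_trans)
qed

end
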